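(* Let $\Delta$ be a finite $(d-1)$-dimensional simplicial complex, let $P$ be the poset of nonempty faces of $\Delta$ ordered by inclusion, and let $r\geq 1$. Let $\mathcal{C}^r(\Delta)$ be the clique complex of the graph on the set $P_r$ of $r$-multichains $A_1\subseteq A_2\subseteq\cdots\subseteq A_r$ of nonempty faces of $\Delta$, in which two distinct multichains $\mathfrak{p}=(p_1\subseteq\cdots\subseteq p_r)$ and $\mathfrak{q}=(q_1\subseteq\cdots\subseteq q_r)$ are adjacent iff $\mathfrak{p}\preceq_I\mathfrak{q}$ or $\mathfrak{q}\preceq_I\mathfrak{p}$, where $\mathfrak{p}\preceq_I\mathfrak{q}$ means $p_t\supseteq q_s$ for all $s\leq t-1$ and $p_t\subseteq q_s$ for all $s\geq t$ (for all $t,s\in[r]$). Then for $0\leq k\leq d-1$, $$f_k(\mathcal{C}^r(\Delta))=\sum_{l=0}^{d}\sum_{i=0}^{k}(-1)^{k-i}\binom{k}{i}\big[(r+ri)^l-(r+ri-1)^l\big]f_{l-1}(\Delta),$$ and $f_{-1}(\mathcal{C}^r(\Delta))=f_{-1}(\Delta)=1$.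
   Context: $f_i(\Gamma)$ denotes the number of $i$-dimensional faces (faces of cardinality $i+1$) of a simplicial complex $\Gamma$, with $f_{-1}=1$. The relation $\preceq_I$ is the relation $\preceq_\imath$ for $\imath(t)=2t-1$, where in general $\mathfrak{p}\preceq_\imath\mathfrak{q}$ iff $p_t\geq q_s$ for $s\leq\imath(t)-t$ and $p_t\leq q_s$ for $s>\imath(t)-t$. Convention $0^0=1$. *)

theory Defs
  imports Complex_Main "HOL-Library.FuncSet" "HOL-Library.Ramsey"
begin

text \<open>Abstract simplicial complexes are families of finite sets; the empty set is always a face.\<close>

definition simplicial_complex :: "'a set set \<Rightarrow> bool" where
  "simplicial_complex \<Gamma> \<longleftrightarrow>
     \<Gamma> \<noteq> {} \<and> (\<forall>A\<in>\<Gamma>. finite A) \<and> (\<forall>A\<in>\<Gamma>. \<forall>B\<subseteq>A. B \<in> \<Gamma>)"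

definition face_dim :: "'a set \<Rightarrow> int" where
  "face_dim A = int (card A) - 1"

text \<open>Meaningful for finite complexes only. The complex \<open>{{}}\<close> has dimension \<open>-1\<close>.\<close>

definition complex_dim :: "'a set set \<Rightarrow> int" where
  "complex_dim \<Gamma> = Max (face_dim ` \<Gamma>)"

definition f_num :: "int \<Rightarrow> 'a set set \<Rightarrow> nat" where
  "f_num i \<Gamma> = card {A \<in> \<Gamma>. face_dim A = i}"

definition nonempty_faces :: "'a set set \<Rightarrow> 'a set set" where
  "nonempty_faces \<Gamma> = {A \<in> \<Gamma>. A \<noteq> {}}"

text \<open>An \<open>r\<close>-multichain \<open>p\<^sub>1 \<le> \<dots> \<le> p\<^sub>r\<close> is a monotone function on \<open>{1..r}\<close>;
  extensionality makes it determined by its \<open>r\<close> entries. On sets, \<open>\<le>\<close> is inclusion.\<close>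

definition multichains :: "nat \<Rightarrow> 'b::order set \<Rightarrow> (nat \<Rightarrow> 'b) set" where
  "multichains r P = {p \<in> {1..r} \<rightarrow>\<^sub>E P. mono_on {1..r} p}"

text \<open>As \<open>s \<ge> 1\<close>, the truncated subtraction \<open>\<iota> t - t\<close> gives the same conditions
  as subtraction in the integers.\<close>

definition prec_rel :: "(nat \<Rightarrow> nat) \<Rightarrow> nat \<Rightarrow> (nat \<Rightarrow> 'b::order) \<Rightarrow> (nat \<Rightarrow> 'b) \<Rightarrow> bool" where
  "prec_rel \<iota> r p q \<longleftrightarrow>
     (\<forall>t\<in>{1..r}. \<forall>s\<in>{1..r}.
        (s \<le> \<iota> t - t \<longrightarrow> p t \<ge> q s) \<and> (s > \<iota> t - t \<longrightarrow> p t \<le> q s))"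

definition prec_I :: "nat \<Rightarrow> (nat \<Rightarrow> 'b::order) \<Rightarrow> (nat \<Rightarrow> 'b) \<Rightarrow> bool" where
  "prec_I = prec_rel (\<lambda>t. 2 * t - 1)"

lemma prec_I_iff:
  "prec_I r p q \<longleftrightarrow>
     (\<forall>t\<in>{1..r}. \<forall>s\<in>{1..r}. (s \<le> t - 1 \<longrightarrow> p t \<ge> q s) \<and> (s \<ge> t \<longrightarrow> p t \<le> q s))"
proof -
  have "2 * t - 1 - t = t - 1" "t - 1 < s \<longleftrightarrow> t \<le> s" if "1 \<le> t" for t s :: nat
    using that by auto
  then show ?thesis
    unfolding prec_I_def prec_rel_def by (intro ball_cong refl) auto
qed

definition multichain_edges :: "nat \<Rightarrow> 'b::order set \<Rightarrow> (nat \<Rightarrow> 'b) set set" where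
  "multichain_edges r P =
     {{p, q} | p q. p \<in> multichains r P \<and> q \<in> multichains r P \<and> p \<noteq> q \<and>
                    (prec_I r p q \<or> prec_I r q p)}"

definition clique_complex :: "'v set \<Rightarrow> 'v set set \<Rightarrow> 'v set set" where
  "clique_complex V E = {S. S \<subseteq> V \<and> finite S \<and> clique S E}"

definition Cr_complex :: "nat \<Rightarrow> 'a set set \<Rightarrow> (nat \<Rightarrow> 'a set) set set" where
  "Cr_complex r \<Delta> =
     clique_complex (multichains r (nonempty_faces \<Delta>)) (multichain_edges r (nonempty_faces \<Delta>))"

end

theory Submission
  imports Defs
begin

text \<open>A relation \<open>\<pp> \<preceq>\<^sub>I \<qq>\<close> says \<open>p\<^sub>1 \<le> q\<^sub>1 \<le> p\<^sub>2 \<le> q\<^sub>2 \<le> \<dots> \<le> p\<^sub>r \<le> q\<^sub>r\<close>, so it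
  implies the componentwise order and every clique is linearly ordered. A weakly increasing list of
  \<open>n\<close> pairwise related \<open>r\<close>-multichains is the same as one multichain of length \<open>r * n\<close>, cut into
  \<open>r\<close> blocks of \<open>n\<close> consecutive entries. Multichains of length \<open>m\<close> with top face \<open>A\<close> correspond to
  the maps \<open>A \<rightarrow> {1..m}\<close> attaining the value \<open>1\<close>, where a vertex is sent to the first index at which
  it appears; there are \<open>m ^ l - (m - 1) ^ l\<close> of them if \<open>A\<close> has \<open>l\<close> vertices. On the other hand, a
  clique with \<open>j + 1\<close> elements underlies \<open>k choose j\<close> weakly increasing lists of length \<open>k + 1\<close>, and
  binomial inversion recovers the number of cliques.\<close>

section \<open>Binomial inversion\<close>

text \<open>Choosing a subset of size \<open>i\<close> and then \<open>j\<close> of its elements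
  amounts to choosing the \<open>j\<close> elements first, so a factor free of \<open>i\<close>
  splits off. What remains is the expansion of \<open>(1 + -1) ^ (k - j)\<close>, which vanishes
  unless \<open>j = k\<close>.\<close>

lemma binomial_orthogonality:
  fixes j k :: nat
  assumes "j \<le> k"
  shows "(\<Sum>i\<le>k. (-1) ^ (k - i) * of_nat (k choose i) * of_nat (i choose j))
       = (if j = k then 1 else 0 :: 'a::comm_ring_1)"
proof -
  have "(\<Sum>i\<le>k. (-1) ^ (k - i) * of_nat (k choose i) * of_nat (i choose j))
      = (\<Sum>i=j..k. (-1) ^ (k - i) * of_nat (k choose i) * of_nat (i choose j) :: 'a)"
    by (rule sum.mono_neutral_right) (auto simp: binomial_eq_0)
  also have "\<dots> = (\<Sum>i=j..k. of_nat (k choose j) * ((-1) ^ (k - i) * of_nat ((k - j) choose (i - j))))"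
  proof (rule sum.cong)
    fix i assume "i \<in> {j..k}"
    then have "(k choose i) * (i choose j) = (k choose j) * ((k - j) choose (i - j))"
      by (intro choose_mult) auto
    then have "of_nat (k choose i) * of_nat (i choose j)
        = (of_nat (k choose j) * of_nat ((k - j) choose (i - j)) :: 'a)"
      by (metis of_nat_mult)
    then show "(-1) ^ (k - i) * of_nat (k choose i) * of_nat (i choose j)
        = (of_nat (k choose j) * ((-1) ^ (k - i) * of_nat ((k - j) choose (i - j))) :: 'a)"
      by (simp add: mult.assoc mult.left_commute)
  qed simp
  also have "\<dots> = of_nat (k choose j) * (\<Sum>i=j..k. (-1) ^ (k - i) * of_nat ((k - j) choose (i - j)))"
    by (rule sum_distrib_left[symmetric])
  also have "(\<Sum>i=j..k. (-1) ^ (k - i) * of_nat ((k - j) choose (i - j)))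
      = (\<Sum>i\<le>k - j. of_nat ((k - j) choose i) * 1 ^ i * (-1) ^ (k - j - i) :: 'a)"
    using assms
    by (subst sum.atLeastAtMost_shift_0) (auto simp: atLeast0AtMost mult.commute intro!: sum.cong)
  also have "\<dots> = (1 + -1) ^ (k - j)"
    by (rule binomial_ring[symmetric])
  finally show ?thesis
    using assms by (auto simp: power_0_left)
qed

lemma binomial_inversion:
  fixes f g :: "nat \<Rightarrow> 'a::comm_ring_1"
  assumes g: "\<And>i. i \<le> k \<Longrightarrow> g i = (\<Sum>j\<le>i. of_nat (i choose j) * f j)"
  shows "f k = (\<Sum>i\<le>k. (-1) ^ (k - i) * of_nat (k choose i) * g i)"
proof -
  have "(\<Sum>i\<le>k. (-1) ^ (k - i) * of_nat (k choose i) * g i)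
      = (\<Sum>i\<le>k. \<Sum>j\<le>k. (-1) ^ (k - i) * of_nat (k choose i) * of_nat (i choose j) * f j)"
  proof (rule sum.cong)
    fix i assume "i \<in> {..k}"
    \<comment> \<open>Padding with the zero terms \<open>j > i\<close> makes the inner range
      independent of \<open>i\<close>, so that the two sums can be exchanged.\<close>
    then have "g i = (\<Sum>j\<le>k. of_nat (i choose j) * f j)"
      unfolding g[OF atMost_iff[THEN iffD1, OF \<open>i \<in> {..k}\<close>]]
      by (intro sum.mono_neutral_left) (auto simp: binomial_eq_0)
    then show "(-1) ^ (k - i) * of_nat (k choose i) * g i
        = (\<Sum>j\<le>k. (-1) ^ (k - i) * of_nat (k choose i) * of_nat (i choose j) * f j)"
      by (simp add: sum_distrib_left mult.assoc)
  qed simp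
  also have "\<dots> = (\<Sum>j\<le>k. (\<Sum>i\<le>k. (-1) ^ (k - i) * of_nat (k choose i) * of_nat (i choose j)) * f j)"
    by (subst sum.swap) (simp add: sum_distrib_right)
  also have "\<dots> = (\<Sum>j\<le>k. if j = k then f j else 0)"
    by (rule sum.cong) (auto simp: binomial_orthogonality)
  finally show ?thesis by simp
qed

section \<open>Sorted lists and pairwise comparable sets\<close>

lemma finite_lists_of_length_set:
  "finite S \<Longrightarrow> finite {xs. length xs = n \<and> set xs = S \<and> Q xs}"
  by (rule finite_subset[OF _ finite_lists_length_eq[of S n]]) auto

text \<open>Such a list is determined by the positive multiplicities of the elements of the chain
  \<open>S\<close>, hence by a composition of \<open>n + 1\<close> into \<open>card S\<close> parts.
  The induction deletes the head, which must be the least element \<open>a\<close>; whether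
  \<open>a\<close> occurs again gives the two terms of Pascal's rule.\<close>

lemma card_sorted_lists_with_set:
  fixes S :: "'b::order set"
  assumes "finite S" "S \<noteq> {}" "\<And>x y. x \<in> S \<Longrightarrow> y \<in> S \<Longrightarrow> x \<le> y \<or> y \<le> x"
  shows "card {xs. length xs = Suc n \<and> set xs = S \<and> sorted_wrt (\<le>) xs} = n choose (card S - 1)"
  using assms
proof (induction n arbitrary: S)
  case 0
  have eq: "{xs. length xs = Suc 0 \<and> set xs = S \<and> sorted_wrt (\<le>) xs} = {[x] |x. S = {x}}"
    by (auto simp: length_Suc_conv)
  show ?case
  proof (cases "\<exists>x. S = {x}")
    case True
    then obtain x where "S = {x}" ..
    then show ?thesis unfolding eq by simp
  next
    case False
    then have "card S \<noteq> 1" "card S \<noteq> 0"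
      using 0 by (auto simp: card_1_singleton_iff)
    then show ?thesis unfolding eq using False by (simp add: binomial_eq_0)
  qed
next
  case (Suc n)
  obtain a where a: "a \<in> S" "\<And>x. x \<in> S \<Longrightarrow> a \<le> x"
    using finite_has_minimal[OF Suc.prems(1,2)] Suc.prems(3) by blast
  let ?L = "\<lambda>n S. {xs. length xs = n \<and> set xs = S \<and> sorted_wrt (\<le>) xs}"
  have eq: "?L (Suc (Suc n)) S = (#) a ` (?L (Suc n) S \<union> ?L (Suc n) (S - {a}))"
  proof (intro subset_antisym subsetI)
    fix xs assume xs: "xs \<in> ?L (Suc (Suc n)) S"
    then obtain x ys where x: "xs = x # ys" by (cases xs) auto
    have "x \<le> a" "x \<in> S" using xs x a by auto
    then have "x = a" using a by (simp add: order_antisym)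
    moreover have "set ys = S \<or> set ys = S - {a}"
      using xs x \<open>x = a\<close> by auto
    ultimately show "xs \<in> (#) a ` (?L (Suc n) S \<union> ?L (Suc n) (S - {a}))"
      using xs x by auto
  next
    fix xs assume "xs \<in> (#) a ` (?L (Suc n) S \<union> ?L (Suc n) (S - {a}))"
    then show "xs \<in> ?L (Suc (Suc n)) S" using a by auto
  qed
  have "card (?L (Suc (Suc n)) S) = card (?L (Suc n) S \<union> ?L (Suc n) (S - {a}))"
    unfolding eq by (rule card_image) (simp add: inj_on_def)
  also have "\<dots> = card (?L (Suc n) S) + card (?L (Suc n) (S - {a}))"
    using a Suc.prems(1) by (intro card_Un_disjoint finite_lists_of_length_set) auto
  also have "card (?L (Suc n) S) = n choose (card S - 1)"
    using Suc.prems by (intro Suc.IH) auto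
  also have "(n choose (card S - 1)) + card (?L (Suc n) (S - {a})) = Suc n choose (card S - 1)"
  proof (cases "S - {a} = {}")
    \<comment> \<open>Separate because the induction hypothesis excludes the empty set: there the
      truncated \<open>card S - 1\<close> would predict one list, while no list of positive length
      has an empty set of entries.\<close>
    case True
    then have "S = {a}" using a by auto
    moreover have "?L (Suc n) (S - {a}) = {}" unfolding True by auto
    ultimately show ?thesis by simp
  next
    case False
    have "card (?L (Suc n) (S - {a})) = n choose (card (S - {a}) - 1)"
      using Suc.prems False by (intro Suc.IH) auto
    moreover have "card S - 1 = card (S - {a})"
      using a by simp
    moreover have "card (S - {a}) > 0"
      using False Suc.prems(1) card_gt_0_iff by blast
    ultimately show ?thesis
      by (cases "card (S - {a})") auto
  qed
  finally show ?case .
qed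

text \<open>The lists are grouped by their underlying set. \<open>sorted_wrt R\<close> relates every
  earlier entry to every later one, so this set is pairwise comparable even if \<open>R\<close> is
  not transitive, and on it \<open>R\<close> agrees with the order; a set of size
  \<open>j + 1\<close> then carries \<open>n choose j\<close> lists.\<close>

lemma card_sorted_wrt_lists:
  fixes M :: "'b::order set"
  assumes M: "finite M"
    and R_refl: "\<And>x. x \<in> M \<Longrightarrow> R x x"
    and le: "\<And>x y. x \<in> M \<Longrightarrow> y \<in> M \<Longrightarrow> R x y \<Longrightarrow> x \<le> y"
  shows "card {xs. length xs = Suc n \<and> set xs \<subseteq> M \<and> sorted_wrt R xs}
    = (\<Sum>j\<le>n. (n choose j) *
        card {S. S \<subseteq> M \<and> card S = Suc j \<and> (\<forall>x\<in>S. \<forall>y\<in>S. R x y \<or> R y x)})"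
proof -
  define K where "K j = {S. S \<subseteq> M \<and> card S = Suc j \<and> (\<forall>x\<in>S. \<forall>y\<in>S. R x y \<or> R y x)}" for j
  define L where "L S = {xs. length xs = Suc n \<and> set xs = S \<and> sorted_wrt (\<le>) xs}" for S :: "'b set"
  have finK: "finite (K j)" for j
    unfolding K_def by (rule finite_subset[OF _ finite_Pow_iff[THEN iffD2, OF M]]) auto
  have finL: "finite (L S)" if "S \<in> K j" for S j
    using that M unfolding K_def L_def
    by (intro finite_lists_of_length_set) (auto intro: finite_subset)
  have cardL: "card (L S) = n choose j" if "S \<in> K j" for S j
  proof -
    have S: "S \<subseteq> M" "card S = Suc j" "\<And>x y. x \<in> S \<Longrightarrow> y \<in> S \<Longrightarrow> R x y \<or> R y x"
      using that unfolding K_def by auto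
    then have "card (L S) = n choose (card S - 1)"
      unfolding L_def
      using finite_subset[OF S(1) M] le by (intro card_sorted_lists_with_set) (auto, blast)
    then show ?thesis using S by simp
  qed
  have R_iff: "sorted_wrt R xs \<longleftrightarrow> sorted_wrt (\<le>) xs"
    if "set xs \<subseteq> M" "\<And>x y. x \<in> set xs \<Longrightarrow> y \<in> set xs \<Longrightarrow> R x y \<or> R y x" for xs
  proof
    show "sorted_wrt R xs \<Longrightarrow> sorted_wrt (\<le>) xs"
      by (rule sorted_wrt_mono_rel[of xs R]) (use that(1) le in auto)
    show "sorted_wrt (\<le>) xs \<Longrightarrow> sorted_wrt R xs"
    \<comment> \<open>If only \<open>R y x\<close> were available, then \<open>y \<le> x\<close>,
      hence \<open>x = y\<close> by antisymmetry, and \<open>R x y\<close> holds after all.\<close>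
    proof (rule sorted_wrt_mono_rel[rotated])
      fix x y assume "x \<in> set xs" "y \<in> set xs" "x \<le> y"
      then show "R x y" using that le[of y x] by (metis order_antisym subsetD)
    qed
  qed
  have comparable: "R x y \<or> R y x"
    if "set xs \<subseteq> M" "sorted_wrt R xs" "x \<in> set xs" "y \<in> set xs" for xs x y
  proof -
    obtain a b where ab: "a < length xs" "x = xs ! a" "b < length xs" "y = xs ! b"
      using \<open>x \<in> set xs\<close> \<open>y \<in> set xs\<close> by (metis in_set_conv_nth)
    moreover have "R x x" using that R_refl by blast
    ultimately show ?thesis
      using that(2) by (cases a b rule: linorder_cases) (auto simp: sorted_wrt_iff_nth_less)
  qed
  have eq: "{xs. length xs = Suc n \<and> set xs \<subseteq> M \<and> sorted_wrt R xs} = (\<Union>j\<le>n. \<Union>S\<in>K j. L S)"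
  proof (intro subset_antisym subsetI)
    fix xs assume xs: "xs \<in> {xs. length xs = Suc n \<and> set xs \<subseteq> M \<and> sorted_wrt R xs}"
    then have "card (set xs) \<le> Suc n" "card (set xs) > 0"
      using card_length[of xs] by (auto simp: card_gt_0_iff)
    then have j: "card (set xs) - 1 \<le> n" "card (set xs) = Suc (card (set xs) - 1)" by auto
    have "set xs \<in> K (card (set xs) - 1)" "xs \<in> L (set xs)"
      using xs j(2) comparable[of xs] R_iff[of xs] unfolding K_def L_def by auto
    with j show "xs \<in> (\<Union>j\<le>n. \<Union>S\<in>K j. L S)" by blast
  next
    fix xs assume "xs \<in> (\<Union>j\<le>n. \<Union>S\<in>K j. L S)"
    then show "xs \<in> {xs. length xs = Suc n \<and> set xs \<subseteq> M \<and> sorted_wrt R xs}"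
      using R_iff[of xs] unfolding K_def L_def by auto
  qed
  have "card (\<Union>j\<le>n. \<Union>S\<in>K j. L S) = (\<Sum>j\<le>n. card (\<Union>S\<in>K j. L S))"
    using finK finL by (intro card_UN_disjoint) (auto simp: K_def L_def)
  also have "\<dots> = (\<Sum>j\<le>n. \<Sum>S\<in>K j. card (L S))"
    using finK finL by (intro sum.cong refl card_UN_disjoint) (auto simp: L_def)
  also have "\<dots> = (\<Sum>j\<le>n. (n choose j) * card (K j))"
    by (simp add: cardL mult.commute)
  finally show ?thesis unfolding eq K_def .
qed

section \<open>Multichains and lists of related multichains\<close>

lemma multichains_mono:
  "p \<in> multichains r P \<Longrightarrow> 1 \<le> s \<Longrightarrow> s \<le> t \<Longrightarrow> t \<le> r \<Longrightarrow> p s \<le> p t"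
  unfolding multichains_def by (auto intro: mono_onD)

lemma multichains_mem: "p \<in> multichains r P \<Longrightarrow> 1 \<le> t \<Longrightarrow> t \<le> r \<Longrightarrow> p t \<in> P"
  unfolding multichains_def by auto

lemma multichainsI:
  assumes "\<And>t. 1 \<le> t \<Longrightarrow> t \<le> r \<Longrightarrow> p t \<in> P"
    and "\<And>s t. 1 \<le> s \<Longrightarrow> s \<le> t \<Longrightarrow> t \<le> r \<Longrightarrow> p s \<le> p t"
  shows "restrict p {1..r} \<in> multichains r P"
  unfolding multichains_def using assms by (auto intro!: mono_onI)

lemma multichains_eqI:
  assumes "p \<in> multichains r P" "q \<in> multichains r P"
    and "\<And>t. 1 \<le> t \<Longrightarrow> t \<le> r \<Longrightarrow> p t = q t"
  shows "p = q"
proof (rule PiE_ext)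
  show "p \<in> {1..r} \<rightarrow>\<^sub>E P" "q \<in> {1..r} \<rightarrow>\<^sub>E P"
    using assms(1,2) unfolding multichains_def by auto
qed (use assms(3) in auto)

lemma finite_multichains: "finite P \<Longrightarrow> finite (multichains r P)"
  unfolding multichains_def by (rule finite_subset[of _ "{1..r} \<rightarrow>\<^sub>E P"]) (auto intro: finite_PiE)

lemma prec_I_refl: "p \<in> multichains r P \<Longrightarrow> prec_I r p p"
  unfolding prec_I_iff by (auto intro: multichains_mono)

text \<open>The instance \<open>s = t\<close> of the relation gives the inequality on
  \<open>{1..r}\<close>; elsewhere both functions equal \<open>undefined\<close>. Thus the order on
  the whole function type can serve as the linear order of a clique.\<close>

lemma prec_I_imp_le:
  assumes "p \<in> multichains r P" "q \<in> multichains r P" "prec_I r p q"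
  shows "p \<le> q"
proof (rule le_funI)
  fix t
  show "p t \<le> q t"
  proof (cases "t \<in> {1..r}")
    case True
    then show ?thesis using assms(3) unfolding prec_I_iff by auto
  next
    case False
    then have "p t = undefined" "q t = undefined"
      using assms(1,2) unfolding multichains_def by (auto simp: PiE_def extensional_def)
    then show ?thesis by simp
  qed
qed

text \<open>Entry \<open>t\<close> of list member \<open>j\<close> is the cell \<open>(t, j)\<close>
  of a table. Pairwise \<open>prec_I\<close> together with monotonicity of each member says exactly
  that the table increases weakly in lexicographic order, coordinate \<open>t\<close> first, so
  reading it in that order gives one long multichain.\<close>

lemma card_sorted_prec_I_lists:
  assumes n: "n > 0"
  shows "card {xs. length xs = n \<and> set xs \<subseteq> multichains r P \<and> sorted_wrt (prec_I r) xs}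
       = card (multichains (r * n) P)"
proof -
  \<comment> \<open>List positions \<open>j\<close> start at 0 and multichain indices at 1, whence
    the shifts in \<open>(t - 1) * n + j + 1\<close>: offset \<open>j\<close> within block
    \<open>t\<close>.\<close>
  define \<Phi> where "\<Phi> g = map (\<lambda>j. restrict (\<lambda>t. g ((t - 1) * n + j + 1)) {1..r}) [0..<n]"
    for g :: "nat \<Rightarrow> 'a"
  have \<Phi>_nth: "(\<Phi> g ! j) t = g ((t - 1) * n + j + 1)" if "j < n" "1 \<le> t" "t \<le> r" for g j t
    using that unfolding \<Phi>_def by simp
  have idx: "(t - 1) * n + j + 1 \<le> r * n" if "j < n" "1 \<le> t" "t \<le> r" for j t
  proof -
    have "(t - 1) * n + j + 1 \<le> (t - 1) * n + n" using that by simp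
    also have "\<dots> = t * n" using that by (cases t) auto
    also have "\<dots> \<le> r * n" using that by simp
    finally show ?thesis .
  qed
  have idx_mono: "(s - 1) * n + i + 1 \<le> (t - 1) * n + j + 1"
    if "i < n" "1 \<le> s" "s < t" for i j s t
  proof -
    have "(s - 1) * n + i + 1 \<le> (s - 1) * n + n" using that by simp
    also have "\<dots> = s * n" using that by (cases s) auto
    also have "\<dots> \<le> (t - 1) * n" using that by (intro mult_le_mono1) simp
    finally show ?thesis by simp
  qed
  \<comment> \<open>Division of \<open>i - 1\<close> by \<open>n\<close> recovers block and offset
    from a position.\<close>
  have idx_inv: "(i - 1) mod n < n" "1 \<le> (i - 1) div n + 1" "(i - 1) div n + 1 \<le> r"
    "((i - 1) div n + 1 - 1) * n + (i - 1) mod n + 1 = i" if "1 \<le> i" "i \<le> r * n" for i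
  proof -
    have "i - 1 < r * n" using that by simp
    then have "(i - 1) div n < r" using less_mult_imp_div_less by blast
    then show "(i - 1) div n + 1 \<le> r" by simp
    show "((i - 1) div n + 1 - 1) * n + (i - 1) mod n + 1 = i"
      using that div_mult_mod_eq[of "i - 1" n] by simp
  qed (use n in auto)
  have "bij_betw \<Phi> (multichains (r * n) P)
    {xs. length xs = n \<and> set xs \<subseteq> multichains r P \<and> sorted_wrt (prec_I r) xs}"
    unfolding bij_betw_def
  proof (intro conjI subset_antisym subsetI inj_onI)
    fix g h assume g: "g \<in> multichains (r * n) P" and h: "h \<in> multichains (r * n) P"
      and eq: "\<Phi> g = \<Phi> h"
    show "g = h"
    proof (rule multichains_eqI[OF g h])
      fix i assume "1 \<le> i" "i \<le> r * n"
      note i = idx_inv[OF this]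
      show "g i = h i"
        using \<Phi>_nth[OF i(1-3), of g] \<Phi>_nth[OF i(1-3), of h] unfolding eq i(4) by simp
    qed
  next
    fix xs assume "xs \<in> \<Phi> ` multichains (r * n) P"
    then obtain g where g: "g \<in> multichains (r * n) P" and xs: "xs = \<Phi> g" by auto
    have "length xs = n" unfolding xs \<Phi>_def by simp
    moreover have "set xs \<subseteq> multichains r P"
    proof -
      have "restrict (\<lambda>t. g ((t - 1) * n + j + 1)) {1..r} \<in> multichains r P" if "j < n" for j
      proof (rule multichainsI)
        fix t assume "1 \<le> t" "t \<le> r"
        then show "g ((t - 1) * n + j + 1) \<in> P"
          using idx[OF that] by (intro multichains_mem[OF g]) auto
      next
        fix s t assume "1 \<le> s" "s \<le> t" "t \<le> r"
        then show "g ((s - 1) * n + j + 1) \<le> g ((t - 1) * n + j + 1)"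
          using idx[OF that] by (intro multichains_mono[OF g]) auto
      qed
      then show ?thesis unfolding xs \<Phi>_def by auto
    qed
    moreover have "sorted_wrt (prec_I r) xs"
      unfolding sorted_wrt_iff_nth_less
    proof (intro allI impI)
      fix i j assume "i < j" "j < length xs"
      then have ij: "i < j" "i < n" "j < n" using \<open>length xs = n\<close> by auto
      show "prec_I r (xs ! i) (xs ! j)"
        unfolding prec_I_iff
      proof (intro ballI conjI impI)
        fix t s assume "t \<in> {1..r}" "s \<in> {1..r}"
        then have ts: "1 \<le> t" "t \<le> r" "1 \<le> s" "s \<le> r" by auto
        \<comment> \<open>For \<open>s \<le> t - 1\<close>, block \<open>s\<close> ends before block
          \<open>t\<close> begins, whatever the offsets. For \<open>t \<le> s\<close> the blocks may
          coincide, and then \<open>i < j\<close> decides.\<close>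
        show "(xs ! j) s \<le> (xs ! i) t" if "s \<le> t - 1"
          unfolding xs \<Phi>_nth[OF ij(3) ts(3,4)] \<Phi>_nth[OF ij(2) ts(1,2)]
          using that ts ij idx[OF ij(2) ts(1,2)] idx_mono[OF ij(3) ts(3), of t i]
          by (intro multichains_mono[OF g]) auto
        have "(t - 1) * n \<le> (s - 1) * n" if "t \<le> s"
          using that by (intro mult_le_mono1) simp
        then show "(xs ! i) t \<le> (xs ! j) s" if "t \<le> s"
          unfolding xs \<Phi>_nth[OF ij(3) ts(3,4)] \<Phi>_nth[OF ij(2) ts(1,2)]
          using that ts ij idx[OF ij(3) ts(3,4)]
          by (intro multichains_mono[OF g]) (auto intro: add_mono)
      qed
    qed
    ultimately show "xs \<in> {xs. length xs = n \<and> set xs \<subseteq> multichains r P \<and> sorted_wrt (prec_I r) xs}"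
      by simp
  next
    fix xs assume "xs \<in> {xs. length xs = n \<and> set xs \<subseteq> multichains r P \<and> sorted_wrt (prec_I r) xs}"
    then have len: "length xs = n" and M: "\<And>j. j < n \<Longrightarrow> xs ! j \<in> multichains r P"
      and sorted: "\<And>i j. i < j \<Longrightarrow> j < n \<Longrightarrow> prec_I r (xs ! i) (xs ! j)"
      by (auto simp: sorted_wrt_iff_nth_less)
    define h where "h i = (xs ! ((i - 1) mod n)) ((i - 1) div n + 1)" for i
    define g where "g = restrict h {1..r * n}"
    have "g \<in> multichains (r * n) P"
      unfolding g_def
    proof (rule multichainsI)
      fix i assume "1 \<le> i" "i \<le> r * n"
      note i = idx_inv[OF this]
      show "h i \<in> P" unfolding h_def by (rule multichains_mem[OF M[OF i(1)] i(2,3)])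
    next
      fix i j assume ij: "1 \<le> i" "i \<le> j" "j \<le> r * n"
      define a b s t where "a = (i - 1) mod n" and "b = (j - 1) mod n"
        and "s = (i - 1) div n + 1" and "t = (j - 1) div n + 1"
      have i: "a < n" "1 \<le> s" "s \<le> r" "(s - 1) * n + a + 1 = i"
        using idx_inv[of i] ij unfolding a_def s_def by auto
      have j: "b < n" "1 \<le> t" "t \<le> r" "(t - 1) * n + b + 1 = j"
        using idx_inv[of j] ij unfolding b_def t_def by auto
      have "s \<le> t" unfolding s_def t_def using ij by (simp add: div_le_mono)
      \<comment> \<open>Offsets \<open>a < b\<close> use the second clause of \<open>prec_I\<close>,
        and equal offsets use monotonicity of a single member. If \<open>a > b\<close>, then
        \<open>i \<le> j\<close> forces \<open>s < t\<close>, and the first clause applies with the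
        two members interchanged.\<close>
      have "(xs ! a) s \<le> (xs ! b) t"
      proof (cases a b rule: linorder_cases)
        case less
        then show ?thesis using sorted[OF less j(1)] i j \<open>s \<le> t\<close> unfolding prec_I_iff by auto
      next
        case equal
        then show ?thesis using multichains_mono[OF M[OF i(1)] i(2) \<open>s \<le> t\<close> j(3)] by simp
      next
        case greater
        then have "s \<noteq> t" using i(4) j(4) ij(2) by auto
        then have "s \<le> t - 1" using \<open>s \<le> t\<close> by simp
        then show ?thesis using sorted[OF greater i(1)] i j unfolding prec_I_iff by auto
      qed
      then show "h i \<le> h j" unfolding h_def a_def b_def s_def t_def .
    qed
    moreover have "\<Phi> g = xs"
    proof (rule nth_equalityI)
      show "length (\<Phi> g) = length xs" unfolding \<Phi>_def len by simp
      fix j assume "j < length (\<Phi> g)"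
      then have j: "j < n" unfolding \<Phi>_def by simp
      have "\<Phi> g ! j = restrict (\<lambda>t. g ((t - 1) * n + j + 1)) {1..r}"
        unfolding \<Phi>_def using j by simp
      also have "\<dots> = restrict (xs ! j) {1..r}"
      proof (rule restrict_ext)
        fix t assume "t \<in> {1..r}"
        then show "g ((t - 1) * n + j + 1) = (xs ! j) t"
          using j idx[OF j, of t] unfolding g_def h_def by simp
      qed
      also have "\<dots> = xs ! j"
        using M[OF j] unfolding multichains_def by (auto simp: PiE_def extensional_restrict)
      finally show "\<Phi> g ! j = xs ! j" .
    qed
    ultimately show "xs \<in> \<Phi> ` multichains (r * n) P" by blast
  qed
  then show ?thesis by (rule bij_betw_same_card[symmetric])
qed

section \<open>Counting multichains of faces\<close>

text \<open>A vertex is recorded by the index of its first appearance. The top face being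
  \<open>A\<close> bounds this index by \<open>m\<close>, and the first face is nonempty iff the
  value \<open>1\<close> occurs, so the maps into \<open>{2..m}\<close> are subtracted. For
  \<open>A = {}\<close> both sides are 0, with \<open>0 ^ 0 = 1\<close> when
  \<open>m = 1\<close>.\<close>

lemma card_multichains_with_top:
  assumes \<Delta>: "simplicial_complex \<Delta>" and A: "A \<in> \<Delta>" and m: "m \<ge> 1"
  shows "int (card {g \<in> multichains m (nonempty_faces \<Delta>). g m = A})
       = int m ^ card A - (int m - 1) ^ card A"
proof -
  have finA: "finite A" and down: "\<And>B. B \<subseteq> A \<Longrightarrow> B \<in> \<Delta>"
    using \<Delta> A unfolding simplicial_complex_def by auto
  define D where "D = (A \<rightarrow>\<^sub>E {1..m}) - (A \<rightarrow>\<^sub>E {2..m})"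
  \<comment> \<open>The sublevel sets of \<open>h\<close> recover the chain from the indices of
    first appearance.\<close>
  define \<Psi> where "\<Psi> h = restrict (\<lambda>t. {a \<in> A. h a \<le> t}) {1..m}" for h :: "'a \<Rightarrow> nat"
  have "bij_betw \<Psi> D {g \<in> multichains m (nonempty_faces \<Delta>). g m = A}"
    unfolding bij_betw_def
  proof (intro conjI subset_antisym subsetI inj_onI)
    fix h h' assume h: "h \<in> D" "h' \<in> D" and eq: "\<Psi> h = \<Psi> h'"
    then have ext: "h \<in> A \<rightarrow>\<^sub>E {1..m}" "h' \<in> A \<rightarrow>\<^sub>E {1..m}" unfolding D_def by auto
    show "h = h'"
    proof (rule PiE_ext[OF ext])
      fix a assume a: "a \<in> A"
      have "h a \<le> t \<longleftrightarrow> h' a \<le> t" if "t \<in> {1..m}" for t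
      proof -
        have "{a \<in> A. h a \<le> t} = {a \<in> A. h' a \<le> t}"
          using fun_cong[OF eq, of t] that unfolding \<Psi>_def by simp
        with a show ?thesis by blast
      qed
      moreover have "h a \<in> {1..m}" "h' a \<in> {1..m}" using ext a by auto
      \<comment> \<open>Take \<open>t = h a\<close> and \<open>t = h' a\<close>.\<close>
      ultimately show "h a = h' a" by (meson order_antisym order_refl)
    qed
  next
    fix g assume "g \<in> \<Psi> ` D"
    then obtain h where h: "h \<in> D" "g = \<Psi> h" by auto
    then obtain a where a: "a \<in> A" "h a = 1"
    proof -
      have "h \<in> A \<rightarrow>\<^sub>E {1..m}" "h \<notin> A \<rightarrow>\<^sub>E {2..m}" using h unfolding D_def by auto
      then obtain a where "a \<in> A" "h a \<in> {1..m}" "h a \<notin> {2..m}"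
        by (auto simp: PiE_def Pi_def)
      then show ?thesis using that[of a] by auto
    qed
    have "g \<in> multichains m (nonempty_faces \<Delta>)"
      unfolding h(2) \<Psi>_def
    proof (rule multichainsI)
      fix t :: nat assume "1 \<le> t"
      then have "{a \<in> A. h a \<le> t} \<noteq> {}" using a by auto
      then show "{a \<in> A. h a \<le> t} \<in> nonempty_faces \<Delta>"
        using down unfolding nonempty_faces_def by auto
    qed auto
    moreover have "g m = A"
      using h m unfolding \<Psi>_def D_def by auto
    ultimately show "g \<in> {g \<in> multichains m (nonempty_faces \<Delta>). g m = A}" by simp
  next
    fix g assume "g \<in> {g \<in> multichains m (nonempty_faces \<Delta>). g m = A}"
    then have g: "g \<in> multichains m (nonempty_faces \<Delta>)" "g m = A" by auto
    \<comment> \<open>\<open>LEAST\<close> also ranges over \<open>t > m\<close>, where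
      \<open>g t\<close> is unspecified, but \<open>a \<in> g m\<close> keeps the minimum within
      \<open>{1..m}\<close>.\<close>
    define h where "h = restrict (\<lambda>a. LEAST t. 1 \<le> t \<and> a \<in> g t) A"
    have least: "1 \<le> h a" "a \<in> g (h a)" "\<And>t. 1 \<le> t \<Longrightarrow> a \<in> g t \<Longrightarrow> h a \<le> t"
      if "a \<in> A" for a
    proof -
      have "1 \<le> m \<and> a \<in> g m" using that g m by simp
      then have "1 \<le> (LEAST t. 1 \<le> t \<and> a \<in> g t) \<and> a \<in> g (LEAST t. 1 \<le> t \<and> a \<in> g t)"
        by (rule LeastI)
      then show "1 \<le> h a" "a \<in> g (h a)" using that unfolding h_def by auto
      show "h a \<le> t" if "1 \<le> t" "a \<in> g t" for t
        using that \<open>a \<in> A\<close> unfolding h_def by (auto intro: Least_le)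
    qed
    have sub: "g t \<subseteq> A" if "1 \<le> t" "t \<le> m" for t
      using multichains_mono[OF g(1) that(1,2)] g(2) by simp
    have "h \<in> A \<rightarrow>\<^sub>E {1..m}"
      using least g m by (auto simp: h_def intro: least)
    moreover have "h \<notin> A \<rightarrow>\<^sub>E {2..m}"
    proof
      assume h: "h \<in> A \<rightarrow>\<^sub>E {2..m}"
      have "g 1 \<noteq> {}" using multichains_mem[OF g(1), of 1] m unfolding nonempty_faces_def by simp
      then obtain a where a: "a \<in> g 1" by auto
      then have "a \<in> A" using sub[of 1] m by auto
      then have "h a \<le> 1" "h a \<in> {2..m}"
        using least(3)[OF _ _ a] PiE_mem[OF h] by auto
      then show False by simp
    qed
    ultimately have "h \<in> D" unfolding D_def by simp
    moreover have "g = \<Psi> h"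
    proof
      fix t
      show "g t = \<Psi> h t"
      proof (cases "t \<in> {1..m}")
        case True
        have "a \<in> g t" if "a \<in> A" "h a \<le> t" for a
          using multichains_mono[OF g(1) least(1)[OF that(1)] that(2)] least(2)[OF that(1)] True by auto
        then show ?thesis
          using True least(3) sub[of t] unfolding \<Psi>_def by auto
      next
        case False
        then show ?thesis
          using g(1) unfolding \<Psi>_def multichains_def by (auto simp: PiE_def extensional_def)
      qed
    qed
    ultimately show "g \<in> \<Psi> ` D" by blast
  qed
  then have "card {g \<in> multichains m (nonempty_faces \<Delta>). g m = A} = card D"
    by (rule bij_betw_same_card[symmetric])
  moreover have "int (card D) = int (card (A \<rightarrow>\<^sub>E {1..m})) - int (card (A \<rightarrow>\<^sub>E {2..m}))"
  proof -
    have sub: "(A \<rightarrow>\<^sub>E {2..m}) \<subseteq> (A \<rightarrow>\<^sub>E {1..m})"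
      by (rule PiE_mono) auto
    have fin: "finite (A \<rightarrow>\<^sub>E {1..m})"
      by (rule finite_PiE) (auto intro: finA)
    show ?thesis
      unfolding D_def
      using card_Diff_subset[OF finite_subset[OF sub fin] sub] card_mono[OF fin sub] by simp
  qed
  \<comment> \<open>\<open>{2..m}\<close> has the truncated difference \<open>m - 1\<close> as its
    cardinality; \<open>m \<ge> 1\<close> turns it into the integer difference.\<close>
  moreover have "int (m - 1) = int m - 1" using m by simp
  ultimately show ?thesis
    using finA by (simp add: card_funcsetE)
qed

lemma f_num_pred: "f_num (int l - 1) \<Gamma> = card {A \<in> \<Gamma>. card A = l}"
  unfolding f_num_def face_dim_def by simp

lemma card_multichains_nonempty_faces:
  assumes \<Delta>: "simplicial_complex \<Delta>" "finite \<Delta>"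
    and d: "\<And>A. A \<in> \<Delta> \<Longrightarrow> card A \<le> d" and m: "m \<ge> 1"
  shows "int (card (multichains m (nonempty_faces \<Delta>)))
       = (\<Sum>l=0..d. (int m ^ l - (int m - 1) ^ l) * int (f_num (int l - 1) \<Delta>))"
proof -
  let ?M = "multichains m (nonempty_faces \<Delta>)"
  have fin: "finite ?M"
    using \<Delta>(2) by (intro finite_multichains) (simp add: nonempty_faces_def)
  \<comment> \<open>Indexing by all of \<open>\<Delta>\<close> is harmless: no multichain of
    nonempty faces has top \<open>{}\<close>, and accordingly the formula has a zero term at
    \<open>l = 0\<close>.\<close>
  have "?M = (\<Union>A\<in>\<Delta>. {g \<in> ?M. g m = A})"
    using multichains_mem[of _ m "nonempty_faces \<Delta>" m] m unfolding nonempty_faces_def by auto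
  then have "card ?M = card (\<Union>A\<in>\<Delta>. {g \<in> ?M. g m = A})" by simp
  also have "\<dots> = (\<Sum>A\<in>\<Delta>. card {g \<in> ?M. g m = A})"
    using \<Delta>(2) fin by (intro card_UN_disjoint) auto
  finally have "int (card ?M) = (\<Sum>A\<in>\<Delta>. int m ^ card A - (int m - 1) ^ card A)"
    using card_multichains_with_top[OF \<Delta>(1) _ m] by simp
  also have "\<dots> = (\<Sum>l=0..d. \<Sum>A\<in>{A \<in> \<Delta>. card A = l}. int m ^ card A - (int m - 1) ^ card A)"
    using \<Delta>(2) d by (intro sum.group[symmetric]) auto
  also have "\<dots> = (\<Sum>l=0..d. (int m ^ l - (int m - 1) ^ l) * int (f_num (int l - 1) \<Delta>))"
    by (rule sum.cong) (auto simp: f_num_pred)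
  finally show ?thesis .
qed

section \<open>Face numbers of the clique complex\<close>

text \<open>A clique constrains only distinct vertices; reflexivity of \<open>prec_I\<close> on
  multichains supplies the pairs \<open>p = q\<close>.\<close>

lemma clique_multichain_edges_iff:
  assumes "S \<subseteq> multichains r P"
  shows "clique S (multichain_edges r P) \<longleftrightarrow> (\<forall>p\<in>S. \<forall>q\<in>S. prec_I r p q \<or> prec_I r q p)"
proof -
  have "{p, q} \<in> multichain_edges r P \<longleftrightarrow> prec_I r p q \<or> prec_I r q p"
    if "p \<in> S" "q \<in> S" "p \<noteq> q" for p q
    using that assms unfolding multichain_edges_def by (auto simp: doubleton_eq_iff)
  moreover have "prec_I r p p" if "p \<in> S" for p
    using that assms by (auto intro: prec_I_refl)
  ultimately show ?thesis unfolding clique_def by metis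
qed

text \<open>This puts the face numbers into the form of the summands in
  \<open>card_sorted_wrt_lists\<close>. The finiteness clause of the clique complex is automatic for
  a set of positive cardinality.\<close>

lemma f_num_Cr_complex:
  "f_num (int k) (Cr_complex r \<Delta>) = card {S. S \<subseteq> multichains r (nonempty_faces \<Delta>)
     \<and> card S = Suc k \<and> (\<forall>p\<in>S. \<forall>q\<in>S. prec_I r p q \<or> prec_I r q p)}"
proof -
  have "card S = Suc k \<Longrightarrow> finite S" for S :: "(nat \<Rightarrow> 'a set) set"
    by (rule card_ge_0_finite) simp
  then have "{S \<in> Cr_complex r \<Delta>. card S = Suc k} = {S. S \<subseteq> multichains r (nonempty_faces \<Delta>)
     \<and> card S = Suc k \<and> (\<forall>p\<in>S. \<forall>q\<in>S. prec_I r p q \<or> prec_I r q p)}"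
    unfolding Cr_complex_def clique_complex_def using clique_multichain_edges_iff by blast
  then show ?thesis
    using f_num_pred[of "Suc k" "Cr_complex r \<Delta>"] by simp
qed

lemma f_num_minus_one:
  assumes "{} \<in> \<Gamma>" "\<And>A. A \<in> \<Gamma> \<Longrightarrow> finite A"
  shows "f_num (-1) \<Gamma> = 1"
proof -
  have "{A \<in> \<Gamma>. card A = 0} = {{}}" using assms by auto
  then show ?thesis using f_num_pred[of 0 \<Gamma>] by simp
qed

theorem theorem4p2:
  fixes \<Delta> :: "'a set set" and d r :: nat
  assumes "simplicial_complex \<Delta>" and "finite \<Delta>"
    and "complex_dim \<Delta> = int d - 1"
    and "r \<ge> 1"
  shows "(\<forall>k::nat. int k \<le> int d - 1 \<longrightarrow>
            int (f_num (int k) (Cr_complex r \<Delta>)) =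
              (\<Sum>l=0..d. \<Sum>i=0..k.
                 (-1) ^ (k - i) * int (k choose i) *
                 ((int r + int r * int i) ^ l - (int r + int r * int i - 1) ^ l) *
                 int (f_num (int l - 1) \<Delta>)))
         \<and> f_num (-1) (Cr_complex r \<Delta>) = f_num (-1) \<Delta>
         \<and> f_num (-1) \<Delta> = 1"
proof (intro conjI allI impI)
  have "f_num (-1) (Cr_complex r \<Delta>) = 1"
    by (rule f_num_minus_one) (auto simp: Cr_complex_def clique_complex_def clique_def)
  moreover show one: "f_num (-1) \<Delta> = 1"
    using assms(1) by (intro f_num_minus_one) (auto simp: simplicial_complex_def)
  ultimately show "f_num (-1) (Cr_complex r \<Delta>) = f_num (-1) \<Delta>" by simp
next
  fix k :: nat
  let ?P = "nonempty_faces \<Delta>"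
  let ?f = "\<lambda>j. int (f_num (int j) (Cr_complex r \<Delta>))"
  let ?N = "\<lambda>i. int (card (multichains (r * Suc i) ?P))"
  have d: "card A \<le> d" if "A \<in> \<Delta>" for A
  proof -
    have "face_dim A \<le> complex_dim \<Delta>"
      unfolding complex_dim_def using assms(2) that by (intro Max_ge) auto
    then show ?thesis using assms(3) unfolding face_dim_def by simp
  qed
  have fin: "finite (multichains r ?P)"
    using assms(2) by (intro finite_multichains) (simp add: nonempty_faces_def)
  \<comment> \<open>Both sides count the \<open>prec_I\<close>-sorted lists of \<open>i + 1\<close>
    multichains: once glued into a single multichain of length \<open>r * Suc i\<close>, once
    grouped by their underlying cliques.\<close>
  have "?N i = (\<Sum>j\<le>i. int (i choose j) * ?f j)" for i
    unfolding card_sorted_prec_I_lists[OF zero_less_Suc, symmetric] f_num_Cr_complex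
    by (subst card_sorted_wrt_lists[OF fin prec_I_refl prec_I_imp_le]) auto
  then have "?f k = (\<Sum>i\<le>k. (-1) ^ (k - i) * int (k choose i) * ?N i)"
    by (rule binomial_inversion)
  also have "\<dots> = (\<Sum>i=0..k. \<Sum>l=0..d. (-1) ^ (k - i) * int (k choose i) *
                 ((int r + int r * int i) ^ l - (int r + int r * int i - 1) ^ l) *
                 int (f_num (int l - 1) \<Delta>))"
  proof (rule sum.cong)
    fix i
    \<comment> \<open>The base \<open>r + r * i\<close> of the powers in the formula is the length
      of the glued multichain; it is positive because \<open>r \<ge> 1\<close>, so the count by top
      face applies.\<close>
    have "int (r * Suc i) = int r + int r * int i" by (simp add: algebra_simps)
    moreover have "r * Suc i \<ge> 1" using assms(4) by simp
    ultimately show "(-1) ^ (k - i) * int (k choose i) * ?N i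
      = (\<Sum>l=0..d. (-1) ^ (k - i) * int (k choose i) *
                 ((int r + int r * int i) ^ l - (int r + int r * int i - 1) ^ l) *
                 int (f_num (int l - 1) \<Delta>))"
      using card_multichains_nonempty_faces[OF assms(1,2) d, of "r * Suc i"]
      by (simp only: sum_distrib_left mult.assoc)
  qed auto
  finally show "?f k = (\<Sum>l=0..d. \<Sum>i=0..k. (-1) ^ (k - i) * int (k choose i) *
                 ((int r + int r * int i) ^ l - (int r + int r * int i - 1) ^ l) *
                 int (f_num (int l - 1) \<Delta>))"
    by (subst sum.swap)
qed

end
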